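(* Let $n=3$ and let $\Lambda_0=(\lambda_{10},\lambda_{20},\lambda_{30})\in\mathbb{C}^3$ be the list of eigenvalues (with multiplicity) of a real $3\times 3$ matrix of trace zero; that is, the list is closed under complex conjugation with multiplicity and $\lambda_{10}+\lambda_{20}+\lambda_{30}=0$. Then the solution $\Lambda(t)=(\lambda_1(t),\lambda_2(t),\lambda_3(t))$ of $$\frac{d}{dt}\lambda_i+\lambda_i^2=\frac13\sum_{j=1}^3\lambda_j^2,\qquad i=1,2,3,\qquad \Lambda(0)=\Lambda_0,$$ remains bounded for all time if and only if there is a real number $r\ge 0$ such that $\Lambda_0$ is a permutation of $r(-1,-1,2)$.
   Context: The system is the spectral dynamics of the 3D restricted Euler equations: along particle paths, the $\lambda_i$ are the eigenvalues of the real, trace-free velocity gradient matrix $M$ (incompressibility: $\operatorname{tr}M=0$, which is preserved by the flow). Eigenvalues may be real or complex, complex ones occurring in conjugate pairs. "Remains bounded for all time" means that the solution of the initial value problem exists for all $t\ge 0$ and is bounded on $[0,\infty)$. *)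

theory Defs
  imports "HOL-Analysis.Analysis" "HOL-Computational_Algebra.Fundamental_Theorem_Algebra"
begin

definition charpoly :: "'a::comm_ring_1^'n^'n \<Rightarrow> 'a poly" where
  "charpoly A = det (mat [:0, 1:] - map_matrix (\<lambda>a. [:a:]) A)"

definition mset_of_vec :: "'a^'n \<Rightarrow> 'a multiset" where
  "mset_of_vec v = image_mset (\<lambda>i. v $ i) (mset_set UNIV)"

text \<open>The components of \<open>L\<close>, in some order, are the complex eigenvalues of the real matrix \<open>M\<close>,
  counted with algebraic multiplicity.\<close>

definition eigenvalue_list :: "real^'n^'n \<Rightarrow> complex^'n \<Rightarrow> bool" where
  "eigenvalue_list M L \<longleftrightarrow> proots (charpoly (map_matrix complex_of_real M)) = mset_of_vec L"

text \<open>At \<open>t = 0\<close> the derivative is one-sided.\<close>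

definition global_solution :: "complex^3 \<Rightarrow> (real \<Rightarrow> complex^3) \<Rightarrow> bool" where
  "global_solution L0 L \<longleftrightarrow> L 0 = L0 \<and>
     (\<forall>t\<ge>0. \<forall>i. \<exists>D. ((\<lambda>s. L s $ i) has_vector_derivative D) (at t within {0..}) \<and>
        D + (L t $ i)\<^sup>2 = (1/3) * (\<Sum>j\<in>UNIV. (L t $ j)\<^sup>2))"

text \<open>The right-hand side is a polynomial in the unknowns, so a global solution is unique
  when it exists.\<close>

definition remains_bounded_for_all_time :: "complex^3 \<Rightarrow> bool" where
  "remains_bounded_for_all_time L0 \<longleftrightarrow> (\<exists>L. global_solution L0 L \<and> bounded (L ` {0..}))"

definition is_permutation_of :: "'a^'n \<Rightarrow> 'a^'n \<Rightarrow> bool" where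
  "is_permutation_of v w \<longleftrightarrow> (\<exists>p. p permutes UNIV \<and> (\<forall>i. v $ i = w $ p i))"

text \<open>Spectra of real trace-free \<open>3 \<times> 3\<close> matrices are the lists with zero sum that are closed
  under complex conjugation with multiplicity.\<close>

lemma mset_of_vec_3: "mset_of_vec (v :: 'a^3) = {# v $ 1, v $ 2, v $ 3 #}"
proof -
  have "mset_set (UNIV :: 3 set) = {# 1, 2, 3 #}"
    unfolding UNIV_3 by simp
  thus ?thesis by (simp add: mset_of_vec_def)
qed

lemma charpoly_3:
  fixes A :: "'a::comm_ring_1^3^3"
  shows "charpoly A = [: - det A,
    A$1$1 * A$2$2 - A$1$2 * A$2$1 + A$1$1 * A$3$3 - A$1$3 * A$3$1 + A$2$2 * A$3$3 - A$2$3 * A$3$2,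
    - trace A, 1 :]"
  by (simp add: charpoly_def det_3 trace_def sum_3 mat_def map_matrix_def algebra_simps)

lemma linear_factors_3:
  fixes a b c :: "'a::comm_ring_1"
  shows "[:-a, 1:] * [:-b, 1:] * [:-c, 1:] = [: - (a * b * c), a*b + a*c + b*c, - (a + b + c), 1 :]"
  by (simp add: algebra_simps)

lemma proots_linear_factors_3:
  fixes a b c :: "'a::field"
  shows "proots ([:-a, 1:] * [:-b, 1:] * [:-c, 1:]) = {#a, b, c#}"
  by (simp add: proots_mult del: mult_pCons_left mult_pCons_right)

lemma eigenvalue_list_3:
  fixes M :: "real^3^3"
  shows "eigenvalue_list M L \<longleftrightarrow>
    charpoly (map_matrix complex_of_real M) = [:-(L$1), 1:] * [:-(L$2), 1:] * [:-(L$3), 1:]"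
  (is "_ \<longleftrightarrow> ?q = ?r")
proof
  assume "eigenvalue_list M L"
  hence pr: "proots ?q = {#L$1, L$2, L$3#}"
    by (simp add: eigenvalue_list_def mset_of_vec_3)
  have lc: "lead_coeff ?q = 1" by (simp add: charpoly_3)
  have "?q = smult (lead_coeff ?q) (\<Prod>x\<in>#proots ?q. [:-x, 1:])"
    by (rule complex_poly_decompose_multiset [symmetric])
  also have "\<dots> = ?r" unfolding lc pr by (simp add: mult.assoc del: mult_pCons_left mult_pCons_right)
  finally show "?q = ?r" .
next
  assume "?q = ?r"
  thus "eigenvalue_list M L"
    using proots_linear_factors_3[of "L$1" "L$2" "L$3"]
    by (simp only: eigenvalue_list_def mset_of_vec_3)
qed

lemma real_trace_free_spectrum_iff:
  fixes L :: "complex^3"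
  shows "(\<exists>M :: real^3^3. trace M = 0 \<and> eigenvalue_list M L) \<longleftrightarrow>
    image_mset cnj (mset_of_vec L) = mset_of_vec L \<and> (\<Sum>i\<in>UNIV. L $ i) = 0" (is "?A \<longleftrightarrow> ?B")
proof
  assume ?A
  then obtain M :: "real^3^3" where tr: "trace M = 0" and ev: "eigenvalue_list M L" by blast
  let ?C = "map_matrix complex_of_real M"
  have eq: "charpoly ?C = [:-(L$1), 1:] * [:-(L$2), 1:] * [:-(L$3), 1:]"
    using ev by (simp only: eigenvalue_list_3)
  have cn: "cnj (?C $ i $ j) = ?C $ i $ j" for i j by (simp add: map_matrix_def)
  have tr': "trace ?C = 0"
    using tr by (simp add: trace_def map_matrix_def flip: of_real_sum)
  have c: "det ?C = L$1 * L$2 * L$3"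
    "?C$1$1 * ?C$2$2 - ?C$1$2 * ?C$2$1 + ?C$1$1 * ?C$3$3 - ?C$1$3 * ?C$3$1 + ?C$2$2 * ?C$3$3 - ?C$2$3 * ?C$3$2
      = L$1 * L$2 + L$1 * L$3 + L$2 * L$3"
    "trace ?C = L$1 + L$2 + L$3"
    using eq unfolding charpoly_3 linear_factors_3 by (simp_all only: pCons_eq_iff neg_equal_iff_equal)
  have d: "cnj (det ?C) = det ?C" by (simp add: det_3 map_matrix_def)
  have c0: "cnj (L$1) * cnj (L$2) * cnj (L$3) = L$1 * L$2 * L$3"
    using c(1) d by (metis complex_cnj_mult)
  have c1: "cnj (L$1) * cnj (L$2) + cnj (L$1) * cnj (L$3) + cnj (L$2) * cnj (L$3)
      = L$1 * L$2 + L$1 * L$3 + L$2 * L$3"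
    unfolding complex_cnj_mult[symmetric] complex_cnj_add[symmetric] c(2)[symmetric]
    by (simp only: complex_cnj_mult complex_cnj_add complex_cnj_diff cn)
  have s: "L$1 + L$2 + L$3 = 0" using c(3) tr' by simp
  have c2: "cnj (L$1) + cnj (L$2) + cnj (L$3) = L$1 + L$2 + L$3"
    using s by (metis complex_cnj_add complex_cnj_zero)
  have "[:-cnj (L$1), 1:] * [:-cnj (L$2), 1:] * [:-cnj (L$3), 1:] = [:-(L$1), 1:] * [:-(L$2), 1:] * [:-(L$3), 1:]"
    unfolding linear_factors_3 c0 c1 c2 ..
  hence "{#cnj (L$1), cnj (L$2), cnj (L$3)#} = {#L$1, L$2, L$3#}"
    by (metis proots_linear_factors_3)
  thus ?B using s by (simp add: mset_of_vec_3 sum_3)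
next
  assume B: ?B
  hence m: "{#cnj (L$1), cnj (L$2), cnj (L$3)#} = {#L$1, L$2, L$3#}" and s: "L$1 + L$2 + L$3 = 0"
    by (simp_all add: mset_of_vec_3 sum_3)
  have "[:-cnj (L$1), 1:] * [:-cnj (L$2), 1:] * [:-cnj (L$3), 1:] = [:-(L$1), 1:] * [:-(L$2), 1:] * [:-(L$3), 1:]"
    using arg_cong[OF m, of "\<lambda>N. \<Prod>x\<in>#N. [:-x, 1:]"]
    by (simp add: mult.assoc del: mult_pCons_left mult_pCons_right)
  hence e: "cnj (L$1 * L$2 * L$3) = L$1 * L$2 * L$3"
    "cnj (L$1 * L$2 + L$1 * L$3 + L$2 * L$3) = L$1 * L$2 + L$1 * L$3 + L$2 * L$3"
    unfolding linear_factors_3 by (simp_all only: pCons_eq_iff neg_equal_iff_equal complex_cnj_mult complex_cnj_add)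
  obtain p q where pq: "L$1 * L$2 * L$3 = of_real p" "L$1 * L$2 + L$1 * L$3 + L$2 * L$3 = of_real q"
    using e by (metis Reals_cases Reals_cnj_iff)
  define M :: "real^3^3" where "M = vector [vector [0, 0, p], vector [1, 0, -q], vector [0, 1, 0]]"
  have "trace M = 0" by (simp add: M_def trace_def sum_3)
  moreover have "eigenvalue_list M L"
    unfolding eigenvalue_list_3 charpoly_3 linear_factors_3 s pq
    by (simp add: M_def map_matrix_def det_3 trace_def sum_3)
  ultimately show ?A by blast
qed

end

theory Submission
  imports Defs "HOL-Combinatorics.Permutations"
begin

text \<open>
  Let \<open>e\<^sub>1, q, d\<close> be the elementary symmetric functions of \<open>\<lambda>\<^sub>1, \<lambda>\<^sub>2, \<lambda>\<^sub>3\<close>. Along a solution \<open>e\<^sub>1\<close> is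
  constant, hence \<open>0\<close>, and then the system closes up to \<open>q' = 3 d\<close>, \<open>d' = -(2/3) q\<^sup>2\<close>
  (\<open>symmetric_functions_dynamics\<close>). The initial values of \<open>q\<close> and \<open>d\<close> are real, being
  coefficients of the characteristic polynomial of a real matrix, and a Gronwall estimate keeps
  them real (\<open>invariants_stay_real\<close>).

  For a bounded solution, \<open>d\<close> is nonincreasing; if it were ever negative then \<open>q' = 3 d\<close>
  would drive \<open>q\<close> to \<open>-\<infinity>\<close>. So \<open>d \<ge> 0\<close>. In the same way neither \<open>d\<close> nor \<open>q\<^sup>2\<close> can stay above
  a positive constant, so \<open>q\<close> and \<open>d\<close> both tend to \<open>0\<close>. Since \<open>4 q\<^sup>3 + 27 d\<^sup>2\<close>, which is minus the
  discriminant, is conserved, it vanishes (\<open>bounded_invariants\<close>). Together with \<open>d \<ge> 0\<close> at time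
  \<open>0\<close> this says that the characteristic polynomial is \<open>(x + r)\<^sup>2 (x - 2 r)\<close> with
  \<open>r = (d / 2)\<^bsup>1/3\<^esup> \<ge> 0\<close>.

  Conversely, \<open>t \<mapsto> r / (1 + r t) (-1, -1, 2)\<close> is a solution with initial value
  \<open>r (-1, -1, 2)\<close>; it is bounded on \<open>[0, \<infinity>)\<close> when \<open>r \<ge> 0\<close>.
\<close>

section \<open>Growth estimates on the half-line\<close>

lemma derivative_ge_imp_growth:
  fixes f :: "real \<Rightarrow> real"
  assumes der: "\<And>t. 0 \<le> t \<Longrightarrow> (f has_real_derivative f' t) (at t within {0..})"
    and ge: "\<And>t. a \<le> t \<Longrightarrow> c \<le> f' t" and a: "0 \<le> a" and ab: "a \<le> b"
  shows "f a + c * (b - a) \<le> f b"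
proof (cases "a = b")
  case False
  with ab have "a < b" by simp
  have "(f has_derivative (*) (f' x)) (at x within {a..b})" if "a \<le> x" "x \<le> b" for x
    using der[of x] that a
    by (auto simp: has_field_derivative_def intro: has_derivative_subset)
  from mvt_simple[OF \<open>a < b\<close> this] obtain x where x: "x \<in> {a<..<b}" "f b - f a = f' x * (b - a)"
    by blast
  have "c * (b - a) \<le> f' x * (b - a)"
    using ge[of x] x(1) ab by (intro mult_right_mono) auto
  thus ?thesis using x(2) by simp
qed simp

lemma bounded_imp_derivative_lt:
  fixes f :: "real \<Rightarrow> real"
  assumes der: "\<And>t. 0 \<le> t \<Longrightarrow> (f has_real_derivative f' t) (at t within {0..})"
    and bd: "\<And>t. 0 \<le> t \<Longrightarrow> \<bar>f t\<bar> \<le> B" and a: "0 \<le> a" and c: "0 < c"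
  shows "\<exists>t\<ge>a. f' t < c"
proof (rule ccontr)
  assume "\<not> ?thesis"
  hence ge: "\<And>t. a \<le> t \<Longrightarrow> c \<le> f' t" by force
  define b where "b = a + (2 * B + 1) / c"
  have "0 \<le> B" using bd[of 0] by linarith
  hence ab: "a \<le> b" using c by (simp add: b_def)
  have "f a + c * (b - a) \<le> f b"
    using der ge a ab by (rule derivative_ge_imp_growth)
  moreover have "c * (b - a) = 2 * B + 1" using c by (simp add: b_def)
  ultimately show False using bd[of a] bd[of b] a ab by linarith
qed

section \<open>Dynamics of the symmetric functions\<close>

text \<open>Gronwall's argument for \<open>u = (Im q)\<^sup>2 + (Im d)\<^sup>2\<close>: the imaginary parts satisfy a linear system
  whose coefficients are bounded because \<open>q\<close> is, so \<open>u' \<le> K u\<close>, and \<open>exp (- K t) u(t)\<close> is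
  nonincreasing.\<close>

lemma invariants_stay_real:
  fixes q d :: "real \<Rightarrow> complex"
  assumes dq: "\<And>t. 0 \<le> t \<Longrightarrow> (q has_vector_derivative 3 * d t) (at t within {0..})"
    and dd: "\<And>t. 0 \<le> t \<Longrightarrow> (d has_vector_derivative -(2/3) * (q t)\<^sup>2) (at t within {0..})"
    and bd: "\<And>t. 0 \<le> t \<Longrightarrow> norm (q t) \<le> B"
    and init: "Im (q 0) = 0" "Im (d 0) = 0" and t: "0 \<le> t"
  shows "Im (q t) = 0" "Im (d t) = 0"
proof -
  have x: "((\<lambda>s. Im (q s)) has_real_derivative 3 * Im (d s)) (at s within {0..})" if "0 \<le> s" for s
    using bounded_linear.has_vector_derivative[OF bounded_linear_Im dq[OF that]]
    by (simp add: has_real_derivative_iff_has_vector_derivative)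
  have y: "((\<lambda>s. Im (d s)) has_real_derivative -(4/3) * (Im (q s) * Re (q s))) (at s within {0..})"
    if "0 \<le> s" for s
    using bounded_linear.has_vector_derivative[OF bounded_linear_Im dd[OF that]]
    by (simp add: has_real_derivative_iff_has_vector_derivative power2_eq_square)
  define K where "K = 3 + 4/3 * B"
  define u where "u s = (Im (q s))\<^sup>2 + (Im (d s))\<^sup>2" for s
  define u' where "u' s = 2 * Im (q s) * Im (d s) * (3 - 4/3 * Re (q s))" for s
  have u: "(u has_real_derivative u' s) (at s within {0..})" if "0 \<le> s" for s
    unfolding u_def[abs_def] u'_def
    by (rule derivative_eq_intros x[OF that] y[OF that] refl)+ (simp add: algebra_simps)
  have v: "((\<lambda>s. - exp (- K * s) * u s) has_real_derivative exp (- K * s) * (K * u s - u' s))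
      (at s within {0..})" if "0 \<le> s" for s
    by (rule derivative_eq_intros u[OF that] refl)+ (simp add: algebra_simps)
  have le: "u' s \<le> K * u s" if "0 \<le> s" for s
  proof -
    have "\<bar>Re (q s)\<bar> \<le> B" using abs_Re_le_cmod[of "q s"] bd[OF that] by linarith
    hence 1: "\<bar>3 - 4/3 * Re (q s)\<bar> \<le> K" by (simp add: K_def abs_le_iff)
    have 2: "\<bar>2 * Im (q s) * Im (d s)\<bar> \<le> u s"
      using sum_squares_bound[of "\<bar>Im (q s)\<bar>" "\<bar>Im (d s)\<bar>"] by (simp add: u_def abs_mult)
    have "u' s \<le> \<bar>2 * Im (q s) * Im (d s)\<bar> * \<bar>3 - 4/3 * Re (q s)\<bar>"
      unfolding u'_def abs_mult[symmetric] by (rule abs_ge_self)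
    also have "\<dots> \<le> u s * K" using 1 2 by (intro mult_mono) auto
    finally show ?thesis by (simp add: mult.commute)
  qed
  have "- exp (- K * 0) * u 0 + 0 * (t - 0) \<le> - exp (- K * t) * u t"
    by (rule derivative_ge_imp_growth[OF v]) (use le t in auto)
  moreover have "u 0 = 0" by (simp add: u_def init)
  ultimately have "u t \<le> 0" by (simp add: mult_le_0_iff)
  thus "Im (q t) = 0" "Im (d t) = 0"
    by (simp_all add: u_def sum_power2_le_zero_iff)
qed

text \<open>The conserved quantity \<open>4 q\<^sup>3 + 27 d\<^sup>2\<close> is shown to vanish without forming limits: as \<open>d\<close> is
  nonnegative and nonincreasing, once \<open>d < \<epsilon>\<close> this persists, and at some later time also
  \<open>\<bar>q\<bar> < \<epsilon>\<close>.\<close>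

lemma bounded_invariants:
  fixes q d :: "real \<Rightarrow> real"
  assumes dq: "\<And>t. 0 \<le> t \<Longrightarrow> (q has_real_derivative 3 * d t) (at t within {0..})"
    and dd: "\<And>t. 0 \<le> t \<Longrightarrow> (d has_real_derivative -(2/3) * (q t)\<^sup>2) (at t within {0..})"
    and bq: "\<And>t. 0 \<le> t \<Longrightarrow> \<bar>q t\<bar> \<le> B" and bd: "\<And>t. 0 \<le> t \<Longrightarrow> \<bar>d t\<bar> \<le> C"
  shows "0 \<le> d 0" "4 * (q 0)^3 + 27 * (d 0)\<^sup>2 = 0"
proof -
  have mq: "((\<lambda>s. - q s) has_real_derivative - (3 * d t)) (at t within {0..})"
    and md: "((\<lambda>s. - d s) has_real_derivative 2/3 * (q t)\<^sup>2) (at t within {0..})" if "0 \<le> t" for t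
    using DERIV_minus[OF dq[OF that]] DERIV_minus[OF dd[OF that]] by simp_all
  have mono: "d t \<le> d s" if "0 \<le> s" "s \<le> t" for s t
    using derivative_ge_imp_growth[OF md, of s 0 t] that by simp
  have nonneg: "0 \<le> d t" if "0 \<le> t" for t
  proof (rule ccontr)
    assume "\<not> 0 \<le> d t"
    hence "\<exists>s\<ge>t. - (3 * d s) < - (3 * d t)"
      using bq that by (intro bounded_imp_derivative_lt[OF mq]) auto
    thus False using mono[OF that] by force
  qed
  show "0 \<le> d 0" by (rule nonneg) simp
  define E where "E t = 4 * (q t)^3 + 27 * (d t)\<^sup>2" for t
  have dE: "(E has_vector_derivative 0) (at t within {0..})" if "0 \<le> t" for t
  proof -
    have "(E has_real_derivative 0) (at t within {0..})"
      unfolding E_def[abs_def]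
      by (rule derivative_eq_intros dq[OF that] dd[OF that] refl)+
         (simp add: algebra_simps power2_eq_square)
    thus ?thesis by (simp add: has_real_derivative_iff_has_vector_derivative)
  qed
  obtain k where k: "\<And>t. 0 \<le> t \<Longrightarrow> E t = k"
    using has_vector_derivative_zero_constant[of "{0..}" E] dE by auto
  \<comment> \<open>The constant is \<open>31 = 4 + 27\<close>, since \<open>\<bar>q\<bar>\<^sup>3, d\<^sup>2 < e\<close> at a suitable time.\<close>
  have small: "\<bar>k\<bar> < 31 * e" if e: "0 < e" "e \<le> 1" for e
  proof -
    obtain s where s: "0 \<le> s" "3 * d s < 3 * e"
      using bounded_imp_derivative_lt[OF dq bq, of 0 "3 * e"] e by auto
    obtain t where t: "s \<le> t" "2/3 * (q t)\<^sup>2 < 2/3 * e\<^sup>2"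
      using bounded_imp_derivative_lt[OF md, of C s "2/3 * e\<^sup>2"] e s bd by auto
    have t0: "0 \<le> t" using s t by simp
    have d: "\<bar>d t\<bar> < e" using mono[of s t] s t nonneg[OF t0] by simp
    have "\<bar>q t\<bar>\<^sup>2 < e\<^sup>2" using t(2) by simp
    hence q: "\<bar>q t\<bar> < e" using e power2_less_imp_less by fastforce
    have pw: "x ^ Suc n < e" if "0 \<le> x" "x < e" for x :: real and n
    proof -
      have "x ^ n \<le> 1" using that e by (intro power_le_one) auto
      hence "x * x ^ n \<le> x * 1" using that by (intro mult_left_mono) auto
      thus ?thesis using that by simp
    qed
    have "\<bar>d t\<bar>\<^sup>2 < e" "\<bar>q t\<bar> ^ 3 < e"
      using pw[of "\<bar>d t\<bar>" 1] pw[of "\<bar>q t\<bar>" 2] q d by (simp_all add: eval_nat_numeral)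
    moreover have "\<bar>k\<bar> \<le> 4 * \<bar>q t\<bar> ^ 3 + 27 * \<bar>d t\<bar>\<^sup>2"
      using k[OF t0] abs_triangle_ineq[of "4 * (q t)^3" "27 * (d t)\<^sup>2"]
      by (simp add: E_def abs_mult power_abs)
    ultimately show ?thesis by linarith
  qed
  have "k = 0"
  proof (rule ccontr)
    assume "k \<noteq> 0"
    hence "\<bar>k\<bar> < 31 * min 1 (\<bar>k\<bar> / 31)" by (intro small) auto
    thus False by linarith
  qed
  thus "4 * (q 0)^3 + 27 * (d 0)\<^sup>2 = 0" using k[of 0] by (simp add: E_def)
qed

lemma symmetric_functions_dynamics:
  fixes a b c :: "real \<Rightarrow> complex"
  defines "S \<equiv> \<lambda>t. 1/3 * ((a t)\<^sup>2 + (b t)\<^sup>2 + (c t)\<^sup>2)"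
  assumes da: "\<And>t. 0 \<le> t \<Longrightarrow> (a has_vector_derivative S t - (a t)\<^sup>2) (at t within {0..})"
    and db: "\<And>t. 0 \<le> t \<Longrightarrow> (b has_vector_derivative S t - (b t)\<^sup>2) (at t within {0..})"
    and dc: "\<And>t. 0 \<le> t \<Longrightarrow> (c has_vector_derivative S t - (c t)\<^sup>2) (at t within {0..})"
    and init: "a 0 + b 0 + c 0 = 0" and t: "0 \<le> t"
  shows "((\<lambda>s. a s * b s + a s * c s + b s * c s) has_vector_derivative 3 * (a t * b t * c t))
      (at t within {0..})"
    and "((\<lambda>s. a s * b s * c s) has_vector_derivative
      -(2/3) * (a t * b t + a t * c t + b t * c t)\<^sup>2) (at t within {0..})"
proof -
  have "((\<lambda>s. a s + b s + c s) has_vector_derivative 0) (at s within {0..})" if "0 \<le> s" for s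
    by (rule derivative_eq_intros da[OF that] db[OF that] dc[OF that] refl)+ (simp add: S_def field_simps)
  then obtain k where k: "\<And>s. 0 \<le> s \<Longrightarrow> a s + b s + c s = k"
    using has_vector_derivative_zero_constant[of "{0..}" "\<lambda>s. a s + b s + c s"] by auto
  have "a t + b t + c t = 0" using k[OF t] k[of 0] init by simp
  hence ct: "c t = - a t - b t" by (simp add: algebra_simps eq_neg_iff_add_eq_0)
  show "((\<lambda>s. a s * b s + a s * c s + b s * c s) has_vector_derivative 3 * (a t * b t * c t))
      (at t within {0..})"
    by (rule derivative_eq_intros da[OF t] db[OF t] dc[OF t] refl)+
       (simp add: S_def ct field_simps power2_eq_square)
  show "((\<lambda>s. a s * b s * c s) has_vector_derivative
      -(2/3) * (a t * b t + a t * c t + b t * c t)\<^sup>2) (at t within {0..})"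
    by (rule derivative_eq_intros da[OF t] db[OF t] dc[OF t] refl)+
       (simp add: S_def ct field_simps power2_eq_square)
qed

section \<open>The two implications\<close>

lemma mset_of_vec_eq_imp_permutation:
  assumes "mset_of_vec v = mset_of_vec w"
  shows "is_permutation_of v w"
  using assms image_mset_eq_implies_permutes[of UNIV "\<lambda>i. v $ i" "\<lambda>i. w $ i"]
  unfolding mset_of_vec_def is_permutation_of_def by (metis finite UNIV_I)

lemma real_spectrum_coefficients:
  fixes M :: "real^3^3" and L :: "complex^3"
  assumes "trace M = 0" "eigenvalue_list M L"
  shows "L$1 + L$2 + L$3 = 0" "Im (L$1 * L$2 + L$1 * L$3 + L$2 * L$3) = 0"
    "Im (L$1 * L$2 * L$3) = 0"
proof -
  let ?C = "map_matrix complex_of_real M"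
  have eq: "charpoly ?C = [:-(L$1), 1:] * [:-(L$2), 1:] * [:-(L$3), 1:]"
    using assms(2) by (simp only: eigenvalue_list_3)
  have tr: "trace ?C = 0"
    using assms(1) by (simp add: trace_def map_matrix_def flip: of_real_sum)
  have c: "det ?C = L$1 * L$2 * L$3"
    "?C$1$1 * ?C$2$2 - ?C$1$2 * ?C$2$1 + ?C$1$1 * ?C$3$3 - ?C$1$3 * ?C$3$1
        + ?C$2$2 * ?C$3$3 - ?C$2$3 * ?C$3$2
      = L$1 * L$2 + L$1 * L$3 + L$2 * L$3"
    "trace ?C = L$1 + L$2 + L$3"
    using eq unfolding charpoly_3 linear_factors_3
    by (simp_all only: pCons_eq_iff neg_equal_iff_equal)
  show "L$1 + L$2 + L$3 = 0" using c(3) tr by simp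
  show "Im (L$1 * L$2 + L$1 * L$3 + L$2 * L$3) = 0"
    unfolding c(2)[symmetric] by (simp add: map_matrix_def)
  show "Im (L$1 * L$2 * L$3) = 0"
    unfolding c(1)[symmetric] by (simp add: det_3 map_matrix_def)
qed

lemma vanishing_discriminant_imp_permutation:
  fixes L :: "complex^3" and q d :: real
  assumes s: "L$1 + L$2 + L$3 = 0" and q: "L$1 * L$2 + L$1 * L$3 + L$2 * L$3 = of_real q"
    and d: "L$1 * L$2 * L$3 = of_real d" and "0 \<le> d" and disc: "4 * q^3 + 27 * d\<^sup>2 = 0"
  shows "\<exists>r\<ge>0::real. is_permutation_of L (r *\<^sub>R vector [-1, -1, 2])"
proof -
  define r where "r = root 3 (d / 2)"
  have r0: "0 \<le> r" using \<open>0 \<le> d\<close> by (simp add: r_def)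
  have "r ^ 3 = d / 2" by (simp add: r_def odd_real_root_pow)
  hence dr: "d = 2 * r ^ 3" by simp
  have "q ^ 3 = (-3 * r\<^sup>2) ^ 3"
    using disc unfolding dr by (simp add: power_mult_distrib flip: power_mult)
  hence qr: "q = -3 * r\<^sup>2" using odd_real_root_power_cancel[of 3] by (metis odd_numeral)
  let ?w = "r *\<^sub>R vector [-1, -1, 2] :: complex^3"
  \<comment> \<open>Both sides are \<open>x\<^sup>3 - 3 r\<^sup>2 x - 2 r\<^sup>3\<close>.\<close>
  have "[:-(L$1), 1:] * [:-(L$2), 1:] * [:-(L$3), 1:]
      = [:-(?w$1), 1:] * [:-(?w$2), 1:] * [:-(?w$3), 1:]"
    unfolding linear_factors_3 s q d dr qr
    by (simp add: scaleR_conv_of_real[where 'a = complex] power2_eq_square power3_eq_cube algebra_simps)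
  hence "mset_of_vec L = mset_of_vec ?w"
    unfolding mset_of_vec_3 by (metis proots_linear_factors_3)
  thus ?thesis using r0 mset_of_vec_eq_imp_permutation by blast
qed

lemma bounded_solution_imp_permutation:
  fixes M :: "real^3^3"
  assumes "trace M = 0" "eigenvalue_list M L0" and sol: "global_solution L0 L"
    and bdd: "bounded (L ` {0..})"
  shows "\<exists>r\<ge>0::real. is_permutation_of L0 (r *\<^sub>R vector [-1, -1, 2])"
proof -
  define q where "q t = L t $ 1 * L t $ 2 + L t $ 1 * L t $ 3 + L t $ 2 * L t $ 3" for t
  define d where "d t = L t $ 1 * L t $ 2 * L t $ 3" for t
  have L0: "L 0 = L0" using sol by (simp add: global_solution_def)
  note init = real_spectrum_coefficients[OF assms(1,2), folded L0]
  have der: "((\<lambda>s. L s $ i) has_vector_derivative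
      1/3 * ((L t $ 1)\<^sup>2 + (L t $ 2)\<^sup>2 + (L t $ 3)\<^sup>2) - (L t $ i)\<^sup>2) (at t within {0..})"
    if t: "0 \<le> t" for t i
  proof -
    obtain D where D: "((\<lambda>s. L s $ i) has_vector_derivative D) (at t within {0..})"
      "D + (L t $ i)\<^sup>2 = 1/3 * (\<Sum>j\<in>UNIV. (L t $ j)\<^sup>2)"
      using sol t unfolding global_solution_def by blast
    have "D = 1/3 * ((L t $ 1)\<^sup>2 + (L t $ 2)\<^sup>2 + (L t $ 3)\<^sup>2) - (L t $ i)\<^sup>2"
      using D(2) by (simp add: sum_3 algebra_simps)
    with D(1) show ?thesis by simp
  qed
  have dq: "(q has_vector_derivative 3 * d t) (at t within {0..})"
    and dd: "(d has_vector_derivative -(2/3) * (q t)\<^sup>2) (at t within {0..})" if "0 \<le> t" for t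
    unfolding q_def[abs_def] d_def[abs_def]
    using symmetric_functions_dynamics[of "\<lambda>t. L t $ 1" "\<lambda>t. L t $ 2" "\<lambda>t. L t $ 3",
        OF der der der init(1) that] by simp_all
  obtain B where B: "\<And>t. 0 \<le> t \<Longrightarrow> norm (L t) \<le> B"
    using bdd by (auto simp: bounded_iff)
  have Bi: "norm (L t $ i) \<le> B" if "0 \<le> t" for t i
    using Finite_Cartesian_Product.norm_nth_le[of "L t" i] B[OF that] by linarith
  have B0: "0 \<le> B" using norm_ge_zero[of "L 0"] B[of 0] by linarith
  have Bm: "norm (L t $ i * L t $ j) \<le> B * B" if "0 \<le> t" for t i j
    unfolding norm_mult using Bi[OF that] B0 by (intro mult_mono) auto
  have bq: "norm (q t) \<le> 3 * (B * B)" if "0 \<le> t" for t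
    using norm_triangle_ineq[of "L t $ 1 * L t $ 2 + L t $ 1 * L t $ 3" "L t $ 2 * L t $ 3"]
      norm_triangle_ineq[of "L t $ 1 * L t $ 2" "L t $ 1 * L t $ 3"]
      Bm[OF that, of 1 2] Bm[OF that, of 1 3] Bm[OF that, of 2 3]
    unfolding q_def by linarith
  have bd: "norm (d t) \<le> B * B * B" if "0 \<le> t" for t
    unfolding d_def norm_mult[of "L t $ 1 * L t $ 2"]
    using Bm[OF that] Bi[OF that] B0 by (intro mult_mono) auto
  have im: "Im (q t) = 0" "Im (d t) = 0" if "0 \<le> t" for t
    using invariants_stay_real[OF dq dd bq _ _ that] init by (auto simp: q_def d_def)
  have rq: "((\<lambda>s. Re (q s)) has_real_derivative 3 * Re (d t)) (at t within {0..})"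
    and rd: "((\<lambda>s. Re (d s)) has_real_derivative -(2/3) * (Re (q t))\<^sup>2) (at t within {0..})"
    if "0 \<le> t" for t
    using bounded_linear.has_vector_derivative[OF bounded_linear_Re dq[OF that]]
      bounded_linear.has_vector_derivative[OF bounded_linear_Re dd[OF that]] im[OF that]
    by (simp_all add: has_real_derivative_iff_has_vector_derivative power2_eq_square)
  have re: "\<bar>Re (q t)\<bar> \<le> 3 * (B * B)" "\<bar>Re (d t)\<bar> \<le> B * B * B" if "0 \<le> t" for t
    using abs_Re_le_cmod[of "q t"] abs_Re_le_cmod[of "d t"] bq[OF that] bd[OF that] by linarith+
  have "0 \<le> Re (d 0)" "4 * (Re (q 0))^3 + 27 * (Re (d 0))\<^sup>2 = 0"
    using bounded_invariants[OF rq rd re] by simp_all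
  moreover have "q 0 = of_real (Re (q 0))" "d 0 = of_real (Re (d 0))"
    using im[of 0] by (simp_all add: complex_eq_iff)
  ultimately show ?thesis
    using vanishing_discriminant_imp_permutation[OF init(1), of "Re (q 0)" "Re (d 0)"]
    by (simp add: q_def d_def L0)
qed

lemma permutation_imp_remains_bounded:
  assumes r: "0 \<le> r" and "is_permutation_of L0 (r *\<^sub>R vector [-1, -1, 2])"
  shows "remains_bounded_for_all_time L0"
proof -
  define w :: "complex^3" where "w = vector [-1, -1, 2]"
  obtain p where p: "p permutes UNIV" and L0: "\<And>i. L0 $ i = r *\<^sub>R w $ p i"
    using assms(2) by (auto simp: is_permutation_of_def w_def)
  define v :: "complex^3" where "v = (\<chi> i. w $ p i)"
  have "(\<Sum>j\<in>UNIV. (v $ j)\<^sup>2) = (\<Sum>j\<in>UNIV. (w $ j)\<^sup>2)"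
    using sum.permute[OF p, of "\<lambda>j. (w $ j)\<^sup>2"] by (simp add: v_def o_def)
  hence sum_v: "(\<Sum>j\<in>UNIV. (v $ j)\<^sup>2) = 6" by (simp add: w_def sum_3)
  \<comment> \<open>\<open>-1\<close> and \<open>2\<close> are the roots of \<open>x\<^sup>2 = x + 2\<close>, which turns the system into \<open>\<rho>' = - \<rho>\<^sup>2\<close>.\<close>
  have "(w $ i)\<^sup>2 = w $ i + 2" for i
    using exhaust_3[of i] by (auto simp: w_def)
  hence v: "(v $ i)\<^sup>2 = v $ i + 2" for i by (simp add: v_def)
  define \<rho> where "\<rho> t = r / (1 + r * t)" for t
  define L where "L t = \<rho> t *\<^sub>R v" for t
  have "global_solution L0 L"
    unfolding global_solution_def
  proof (intro conjI allI impI)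
    show "L 0 = L0" by (simp add: L_def \<rho>_def vec_eq_iff v_def L0)
  next
    fix t :: real and i assume t: "0 \<le> t"
    have "1 + r * t \<noteq> 0" using mult_nonneg_nonneg[OF r t] by linarith
    hence "(\<rho> has_real_derivative - (\<rho> t)\<^sup>2) (at t within {0..})"
      unfolding \<rho>_def[abs_def]
      by (auto intro!: derivative_eq_intros simp: power2_eq_square divide_simps)
    hence "((\<lambda>s. L s $ i) has_vector_derivative (- (\<rho> t)\<^sup>2) *\<^sub>R v $ i) (at t within {0..})"
      unfolding L_def vector_scaleR_component
      by (auto intro!: derivative_eq_intros)
    moreover have "(- (\<rho> t)\<^sup>2) *\<^sub>R v $ i + (L t $ i)\<^sup>2 = 1/3 * (\<Sum>j\<in>UNIV. (L t $ j)\<^sup>2)"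
    proof -
      have "(\<Sum>j\<in>UNIV. (L t $ j)\<^sup>2) = (of_real (\<rho> t))\<^sup>2 * 6"
        by (simp add: L_def scaleR_conv_of_real[where 'a = complex] power_mult_distrib sum_v flip: sum_distrib_left)
      thus ?thesis
        by (simp add: L_def scaleR_conv_of_real[where 'a = complex] power_mult_distrib v algebra_simps)
    qed
    ultimately show "\<exists>D. ((\<lambda>s. L s $ i) has_vector_derivative D) (at t within {0..}) \<and>
        D + (L t $ i)\<^sup>2 = 1/3 * (\<Sum>j\<in>UNIV. (L t $ j)\<^sup>2)" by blast
  qed
  moreover have "bounded (L ` {0..})"
  proof -
    have "norm (L t) \<le> r * norm v" if "0 \<le> t" for t
    proof -
      have 1: "1 \<le> 1 + r * t" using r that by simp
      hence "0 \<le> \<rho> t" "\<rho> t \<le> r" using r 1 frac_le[of r r 1 "1 + r * t"] by (auto simp: \<rho>_def)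
      thus ?thesis by (simp add: L_def mult_right_mono)
    qed
    thus ?thesis by (auto simp: bounded_iff)
  qed
  ultimately show ?thesis by (auto simp: remains_bounded_for_all_time_def)
qed

theorem theorem1p1:
  fixes M :: "real^3^3" and \<Lambda>\<^sub>0 :: "complex^3"
  assumes "trace M = 0" and "eigenvalue_list M \<Lambda>\<^sub>0"
  shows "remains_bounded_for_all_time \<Lambda>\<^sub>0 \<longleftrightarrow>
    (\<exists>r\<ge>0::real. is_permutation_of \<Lambda>\<^sub>0 (r *\<^sub>R vector [-1, -1, 2]))"
  using bounded_solution_imp_permutation[OF assms] permutation_imp_remains_bounded
  unfolding remains_bounded_for_all_time_def by blast

end
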